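(* There are infinitely many positive integers $N$ for which there exists a quadratic polynomial $g(z) \in \mathbb{Q}[z]$ with a $\operatorname{Gal}(\overline{\mathbb{Q}}/\mathbb{Q})$-stable $N$-cycle.
   Context: Let $g^{\circ n}$ denote the $n$-fold composition of $g$ with itself. An $N$-cycle of $g$ is a set $\{x,g(x),\ldots,g^{\circ(N-1)}(x)\}$ where $g^{\circ N}(x)=x$ and $x$ has no smaller period, i.e. $g^{\circ n}(x)\neq x$ for $1\le n<N$. Here $x\in\overline{\mathbb{Q}}$. The cycle is $\operatorname{Gal}(\overline{\mathbb{Q}}/\mathbb{Q})$-stable if it is mapped to itself, as a set, by every element of $\operatorname{Gal}(\overline{\mathbb{Q}}/\mathbb{Q})$. *)

theory Defs
  imports
    "HOL-Algebra.Algebraic_Closure_Type"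
    "HOL-Computational_Algebra.Polynomial"
begin

type_synonym Qbar = "rat alg_closure"

text \<open>The underlying set of \<open>Gal(Qbar/Q)\<close>: its elements are the field automorphisms of \<open>Qbar\<close>
  that fix the embedded copy \<open>range to_ac\<close> of the rationals pointwise.\<close>

definition Gal_Q :: "(Qbar \<Rightarrow> Qbar) set" where
  "Gal_Q = {\<sigma>. bij \<sigma> \<and> (\<forall>x y. \<sigma> (x + y) = \<sigma> x + \<sigma> y) \<and> (\<forall>x y. \<sigma> (x * y) = \<sigma> x * \<sigma> y) \<and>
    (\<forall>q. \<sigma> (to_ac q) = to_ac q)}"

definition Gal_stable :: "Qbar set \<Rightarrow> bool" where
  "Gal_stable C \<longleftrightarrow> (\<forall>\<sigma>\<in>Gal_Q. \<sigma> ` C = C)"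

definition is_cycle :: "nat \<Rightarrow> (Qbar \<Rightarrow> Qbar) \<Rightarrow> Qbar set \<Rightarrow> bool" where
  "is_cycle N f C \<longleftrightarrow> (\<exists>x. C = (\<lambda>n. (f ^^ n) x) ` {..<N} \<and> (f ^^ N) x = x \<and>
    (\<forall>n. 1 \<le> n \<and> n < N \<longrightarrow> (f ^^ n) x \<noteq> x))"

definition eval_Qbar :: "rat poly \<Rightarrow> Qbar \<Rightarrow> Qbar" where
  "eval_Qbar g = poly (map_poly to_ac g)"

end

theory Submission
  imports Defs "HOL-Number_Theory.Residue_Primitive_Roots"
begin

text \<open>
  Squaring alone already produces all the cycles needed. Let \<open>\<zeta>\<close> be a primitive root of unity of
  order \<open>3\<^bsup>k+1\<^esup>\<close>. Since 2 is a primitive root modulo every power of 3, the iterates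
  \<open>\<zeta>, \<zeta>\<^sup>2, \<zeta>\<^sup>4, \<dots>\<close> run through all primitive \<open>3\<^bsup>k+1\<^esup>\<close>-th roots of unity before
  returning to \<open>\<zeta>\<close>. These are exactly the roots of the rational polynomial
  \<open>X\<^bsup>2\<cdot>3^k\<^esup> + X\<^bsup>3^k\<^esup> + 1\<close>, so every field automorphism permutes them, and
  \<open>z\<^sup>2\<close> has a stable cycle of length \<open>2\<cdot>3\<^sup>k\<close> for every \<open>k\<close>.

  Stability thus follows once the cycle is known to be the full root set. That set is closed under
  squaring and so contains the cycle, and the two agree because the cycle has \<open>2\<cdot>3\<^sup>k\<close> elements
  while a polynomial of that degree has no more roots. The number theory is concentrated in
  \<open>ord_power_3_2\<close>, the comparison of the cycle with the root set in
  \<open>squaring_orbit_eq_cyclotomic_roots\<close>.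
\<close>

text \<open>
  A primitive root modulo an odd prime \<open>p\<close> stays one modulo all powers of \<open>p\<close> as soon as its
  \<open>(p - 1)\<close>-st power is not 1 modulo \<open>p\<^sup>2\<close>; here \<open>2\<^sup>2 = 4\<close> is not 1 modulo 9.
\<close>
lemma ord_power_3_2: "ord (3 ^ Suc k) (2 :: nat) = 2 * 3 ^ k"
proof -
  have three: "prime (3 :: nat)" by simp
  have "ord 3 (2 :: nat) dvd 2"
    by (subst ord_divides [symmetric]) (simp add: cong_def)
  moreover have "ord 3 (2 :: nat) \<noteq> 1"
    using ord_divides[of 2 1 "3 :: nat"] by (auto simp: cong_def)
  ultimately have "ord 3 (2 :: nat) = 2"
    using two_is_prime_nat prime_nat_iff by blast
  hence "residue_primroot 3 2"
    using three by (simp add: residue_primroot_def totient_prime)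
  moreover have "[2 ^ (3 - 1) \<noteq> 1] (mod (3 :: nat)\<^sup>2)"
    by (simp add: cong_def)
  ultimately have "residue_primroot (3 ^ Suc k) 2"
    using residue_primroot_prime_lift_iff[of 3 2] three by auto
  thus ?thesis
    using totient_prime_power_Suc[OF three, of k] by (simp add: residue_primroot_def)
qed

text \<open>
  The order of \<open>x\<close> divides \<open>p\<^bsup>k+1\<^esup>\<close> but not \<open>p\<^sup>k\<close>, and the divisors of a prime power form a chain,
  so the order is \<open>p\<^bsup>k+1\<^esup>\<close>.
\<close>
lemma prime_power_order_dvd:
  fixes x :: "'a :: field"
  assumes p: "prime (p :: nat)"
    and one: "x ^ p ^ Suc k = 1" and not_one: "x ^ p ^ k \<noteq> 1" and m: "x ^ m = 1"
  shows "p ^ Suc k dvd m"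
proof -
  have "p ^ Suc k \<noteq> 0" using p by (simp add: prime_gt_0_nat)
  then obtain a b where "p ^ Suc k * a = m * b + gcd (p ^ Suc k) m"
    using bezout_nat by blast
  hence "x ^ (p ^ Suc k * a) = x ^ (m * b) * x ^ gcd (p ^ Suc k) m"
    by (metis power_add)
  hence gcd_one: "x ^ gcd (p ^ Suc k) m = 1"
    by (simp only: power_mult one m) simp
  obtain i where i: "i \<le> Suc k" "gcd (p ^ Suc k) m = p ^ i"
    using divides_primepow_nat[OF p, of "gcd (p ^ Suc k) m" "Suc k"] by auto
  have "\<not> i \<le> k"
  proof
    assume "i \<le> k"
    hence "p ^ k = p ^ i * p ^ (k - i)" by (simp flip: power_add)
    with gcd_one i not_one show False by (simp add: power_mult)
  qed
  with i have "gcd (p ^ Suc k) m = p ^ Suc k" by (simp add: le_Suc_eq)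
  thus ?thesis by (metis gcd_dvd2)
qed

lemma funpow_square: "((\<lambda>y :: 'a :: monoid_mult. y ^ 2) ^^ n) x = x ^ 2 ^ n"
  by (induction n) (simp_all flip: power_mult add: mult.commute)

text \<open>
  If two iterates agreed, applying \<open>f\<close> to both until the later one closes up would give a
  smaller period.
\<close>
lemma inj_on_iterates_minimal_period:
  assumes per: "(f ^^ N) x = x" and min: "\<And>n. 1 \<le> n \<Longrightarrow> n < N \<Longrightarrow> (f ^^ n) x \<noteq> x"
  shows "inj_on (\<lambda>n. (f ^^ n) x) {..<N}"
proof (rule linorder_inj_onI)
  fix i j assume "i < j" "j \<in> {..<N}"
  show "(f ^^ i) x \<noteq> (f ^^ j) x"
  proof
    assume "(f ^^ i) x = (f ^^ j) x"
    hence "(f ^^ (N - j)) ((f ^^ i) x) = (f ^^ (N - j)) ((f ^^ j) x)" by simp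
    hence "(f ^^ (N - j + i)) x = (f ^^ (N - j + j)) x" by (simp add: funpow_add)
    with per \<open>j \<in> {..<N}\<close> have "(f ^^ (N - j + i)) x = x" by simp
    moreover have "1 \<le> N - j + i" "N - j + i < N" using \<open>i < j\<close> \<open>j \<in> {..<N}\<close> by auto
    ultimately show False using min by blast
  qed
qed auto

text \<open>
  The polynomial is the cyclotomic polynomial \<open>\<Phi>\<close> of index \<open>3\<^bsup>k+1\<^esup>\<close>, that is
  \<open>\<Phi>\<^sub>3 = X\<^sup>2 + X + 1\<close> evaluated at \<open>X\<^bsup>3^k\<^esup>\<close>.
\<close>
definition cyclotomic_roots :: "nat \<Rightarrow> 'a :: field_char_0 set" where
  "cyclotomic_roots k = {y. y ^ (2 * 3 ^ k) + y ^ 3 ^ k + 1 = 0}"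

lemma cyclotomic_roots_iff:
  "y \<in> cyclotomic_roots k \<longleftrightarrow> (y ^ 3 ^ k)\<^sup>2 + y ^ 3 ^ k + 1 = 0"
  by (simp add: cyclotomic_roots_def mult.commute flip: power_mult)

lemma cyclotomic_roots_finite_card:
  "finite (cyclotomic_roots k :: 'a :: field_char_0 set)"
  "card (cyclotomic_roots k :: 'a set) \<le> 2 * 3 ^ k"
proof -
  define p :: "'a poly" where "p = Polynomial.monom 1 (2 * 3 ^ k) + Polynomial.monom 1 (3 ^ k) + 1"
  have roots: "cyclotomic_roots k = {y. poly p y = 0}"
    by (simp add: cyclotomic_roots_def p_def poly_monom)
  have "poly p 0 = 1" by (simp add: p_def poly_monom power_0_left)
  hence "p \<noteq> 0" by auto
  moreover have "Polynomial.degree p \<le> 2 * 3 ^ k"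
    unfolding p_def by (intro degree_add_le order.trans[OF degree_monom_le]) auto
  ultimately show "finite (cyclotomic_roots k :: 'a set)" "card (cyclotomic_roots k :: 'a set) \<le> 2 * 3 ^ k"
    using card_poly_roots_bound[of p] poly_roots_finite[of p] by (auto simp: roots)
qed

lemma cyclotomic_roots_nonempty:
  "\<exists>x :: 'a :: {alg_closed_field, field_char_0}. x \<in> cyclotomic_roots k"
proof -
  obtain w :: 'a where "poly [:1, 1, 1:] w = 0"
    using alg_closed_imp_poly_has_root[of "[:1, 1, 1 :: 'a:]"] by auto
  moreover obtain x where "x ^ 3 ^ k = w"
    using nth_root_exists[of "3 ^ k" w] by auto
  ultimately show ?thesis
    by (auto simp: cyclotomic_roots_iff power2_eq_square algebra_simps)
qed

text \<open>
  With \<open>w = y\<^bsup>3^k\<^esup>\<close> this is the factorisation \<open>w\<^sup>4 + w\<^sup>2 + 1 = (w\<^sup>2 + w + 1) (w\<^sup>2 - w + 1)\<close>.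
\<close>
lemma cyclotomic_roots_square:
  assumes "y \<in> cyclotomic_roots k"
  shows "y\<^sup>2 \<in> cyclotomic_roots k"
proof -
  define w where "w = y ^ 3 ^ k"
  have "(w\<^sup>2)\<^sup>2 + w\<^sup>2 + 1 = (w\<^sup>2 + w + 1) * (w\<^sup>2 - w + 1)"
    by (simp add: algebra_simps power2_eq_square)
  moreover have "(y\<^sup>2) ^ 3 ^ k = w\<^sup>2"
    by (simp add: w_def mult.commute flip: power_mult)
  ultimately show ?thesis
    using assms by (simp add: cyclotomic_roots_iff w_def)
qed

lemma cyclotomic_roots_order:
  fixes x :: "'a :: field_char_0"
  assumes "x \<in> cyclotomic_roots k"
  shows "x ^ m = 1 \<longleftrightarrow> 3 ^ Suc k dvd m"
proof -
  define w where "w = x ^ 3 ^ k"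
  have w: "w\<^sup>2 + w + 1 = 0" using assms by (simp add: cyclotomic_roots_iff w_def)
  have "w ^ 3 - 1 = (w - 1) * (w\<^sup>2 + w + 1)"
    by (simp add: algebra_simps power2_eq_square power3_eq_cube)
  hence "w ^ 3 = 1" using w by simp
  hence one: "x ^ 3 ^ Suc k = 1" by (simp add: w_def mult.commute flip: power_mult)
  \<comment> \<open>The value of \<open>w\<^sup>2 + w + 1\<close> at 1 is 3, which is where the characteristic enters.\<close>
  have not_one: "x ^ 3 ^ k \<noteq> 1" using w by (auto simp: w_def)
  show ?thesis
  proof
    assume "3 ^ Suc k dvd m"
    then obtain c where "m = 3 ^ Suc k * c" by (rule dvdE)
    thus "x ^ m = 1" by (simp only: power_mult one power_one)
  qed (use prime_power_order_dvd[OF _ one not_one] in simp)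
qed

text \<open>
  Cancelling one factor \<open>x\<close> turns the equation into \<open>2\<^sup>n \<equiv> 1\<close> modulo the order of \<open>x\<close>.
\<close>
lemma square_iterate_eq_iff:
  fixes x :: "'a :: field_char_0"
  assumes x: "x \<in> cyclotomic_roots k"
  shows "x ^ 2 ^ n = x \<longleftrightarrow> 2 * 3 ^ k dvd n"
proof -
  have "x \<noteq> 0" using x by (auto simp: cyclotomic_roots_iff power_0_left)
  moreover have "x ^ 2 ^ n = x * x ^ (2 ^ n - 1)"
    by (simp flip: power_Suc)
  ultimately have "x ^ 2 ^ n = x \<longleftrightarrow> x ^ (2 ^ n - 1) = 1"
    by simp
  also have "\<dots> \<longleftrightarrow> 3 ^ Suc k dvd (2 ^ n - 1 :: nat)"
    by (rule cyclotomic_roots_order[OF x])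
  also have "\<dots> \<longleftrightarrow> [2 ^ n = 1] (mod (3 ^ Suc k :: nat))"
    using cong_altdef_nat[of 1 "2 ^ n" "3 ^ Suc k"] by simp
  also have "\<dots> \<longleftrightarrow> 2 * 3 ^ k dvd n"
    by (simp only: ord_divides ord_power_3_2)
  finally show ?thesis .
qed

lemma squaring_orbit_eq_cyclotomic_roots:
  fixes x :: "'a :: field_char_0"
  assumes x: "x \<in> cyclotomic_roots k"
  shows "(\<lambda>n. ((\<lambda>y. y\<^sup>2) ^^ n) x) ` {..<2 * 3 ^ k} = cyclotomic_roots k"
proof (rule card_subset_eq)
  let ?orbit = "\<lambda>n. ((\<lambda>y. y\<^sup>2) ^^ n) x"
  have "?orbit n \<in> cyclotomic_roots k" for n
    by (induction n) (use x cyclotomic_roots_square in auto)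
  thus sub: "?orbit ` {..<2 * 3 ^ k} \<subseteq> cyclotomic_roots k" by blast
  have "inj_on ?orbit {..<2 * 3 ^ k}"
    by (rule inj_on_iterates_minimal_period)
       (auto simp: funpow_square square_iterate_eq_iff[OF x] dest: dvd_imp_le)
  hence "card (?orbit ` {..<2 * 3 ^ k}) = 2 * 3 ^ k" by (simp add: card_image)
  thus "card (?orbit ` {..<2 * 3 ^ k}) = card (cyclotomic_roots k :: 'a set)"
    using card_mono[OF cyclotomic_roots_finite_card(1) sub] cyclotomic_roots_finite_card(2)[where 'a = 'a, of k]
    by linarith
qed (rule cyclotomic_roots_finite_card)

text \<open>
  An automorphism maps roots of a rational polynomial to roots; being injective on a finite set,
  it permutes them.
\<close>
lemma Gal_stable_cyclotomic_roots: "Gal_stable (cyclotomic_roots k)"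
  unfolding Gal_stable_def
proof
  fix \<sigma> assume "\<sigma> \<in> Gal_Q"
  hence inj: "inj \<sigma>" and add: "\<And>x y. \<sigma> (x + y) = \<sigma> x + \<sigma> y"
    and mult: "\<And>x y. \<sigma> (x * y) = \<sigma> x * \<sigma> y" and rat: "\<And>q. \<sigma> (to_ac q) = to_ac q"
    by (auto simp: Gal_Q_def bij_is_inj)
  have zero: "\<sigma> 0 = 0" and one: "\<sigma> 1 = 1" using rat[of 0] rat[of 1] by simp_all
  have power: "\<sigma> (y ^ n) = \<sigma> y ^ n" for y n
    by (induction n) (simp_all add: one mult)
  have "\<sigma> y \<in> cyclotomic_roots k" if "y \<in> cyclotomic_roots k" for y
  proof -
    have "\<sigma> y ^ (2 * 3 ^ k) + \<sigma> y ^ 3 ^ k + 1 = \<sigma> (y ^ (2 * 3 ^ k) + y ^ 3 ^ k + 1)"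
      by (simp only: add power one)
    with that show ?thesis by (simp add: cyclotomic_roots_def zero)
  qed
  thus "\<sigma> ` cyclotomic_roots k = cyclotomic_roots k"
    by (intro endo_inj_surj cyclotomic_roots_finite_card(1) inj_on_subset[OF inj]) auto
qed

theorem theorem2:
  shows "infinite {N :: nat. N > 0 \<and>
    (\<exists>(g :: rat poly) C. Polynomial.degree g = 2 \<and> is_cycle N (eval_Qbar g) C \<and> Gal_stable C)}"
    (is "infinite ?lengths")
proof (rule infinite_super)
  have square: "eval_Qbar [:0, 0, 1:] = (\<lambda>y. y\<^sup>2)"
    by (simp add: eval_Qbar_def map_poly_pCons fun_eq_iff power2_eq_square)
  show "range (\<lambda>k. 2 * 3 ^ k) \<subseteq> ?lengths"
  proof
    fix N :: nat assume "N \<in> range (\<lambda>k. 2 * 3 ^ k)"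
    then obtain k where N: "N = 2 * 3 ^ k" by blast
    obtain x :: Qbar where x: "x \<in> cyclotomic_roots k"
      using cyclotomic_roots_nonempty by blast
    have "is_cycle N (eval_Qbar [:0, 0, 1:]) (cyclotomic_roots k)"
      unfolding is_cycle_def square N
      using squaring_orbit_eq_cyclotomic_roots[OF x]
      by (intro exI[of _ x]) (auto simp: funpow_square square_iterate_eq_iff[OF x] dest: dvd_imp_le)
    moreover have "Polynomial.degree [:0, 0, 1 :: rat:] = 2" by simp
    ultimately show "N \<in> ?lengths"
      using Gal_stable_cyclotomic_roots[of k] N
      by (intro CollectI conjI exI[of _ "[:0, 0, 1:]"] exI[of _ "cyclotomic_roots k"]) simp_all
  qed
  show "infinite (range (\<lambda>k. 2 * 3 ^ k :: nat))"
    by (rule range_inj_infinite) (simp add: inj_def)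
qed

end
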